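(* Let $0<p<1$ be fixed and $q=1-p$. The expected number $E_n(o(\pi))$ of napkinless guests at a circular table for $n$ people satisfies, as $n\to\infty$, $$E_n\big(o(\pi)\big)=\frac{n(1-pe^q)(1-qe^p)}{pq}+O\Bigl(\frac{1}{n!}\Bigr).$$ In particular, when $p=q=1/2$, $$E_n\big(o(\pi)\big)=n(2-\sqrt{e})^2+O\Bigl(\frac{1}{n!}\Bigr).$$
   Context: Circular table model. There are $n$ places labelled $1,\dots,n$ counter-clockwise around a circular table; place $i-1$ is to the left of place $i$ and place $i+1$ is to its right (indices cyclic). There are $n$ napkins, exactly one between each pair of cyclically consecutive places, so each place has a left napkin and a right napkin (for $n=1$ these are the same single napkin). The guests sit down one at a time in uniformly random order. Independently, each guest prefers the left napkin with probability $p$ and the right napkin with probability $q=1-p$. On sitting down, a guest takes his preferred napkin if it is available; otherwise he takes the other adjacent napkin if that one is available; otherwise he gets no napkin (he is napkinless). The order and the preferences are encoded by a signed permutation $\pi$ of $\{1,\dots,n\}$: $|\pi(i)|$ is the arrival rank of the guest at place $i$, and the sign of $\pi(i)$ is negative if that guest prefers left and positive if he prefers right. Let $\mathcal{C}_n$ be the set of all signed permutations of $\{1,\dots,n\}$, let $|\pi|_-$ and $|\pi|_+$ be the numbers of negative and positive entries of $\pi$, and let $o(\pi)$ be the number of napkinless guests. Then $$E_n\big(o(\pi)\big)=\frac{1}{n!}\sum_{\pi\in\mathcal{C}_n}p^{|\pi|_-}q^{|\pi|_+}\,o(\pi).$$ *)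

theory Defs
  imports Complex_Main "HOL-Library.FuncSet" "HOL-Library.Landau_Symbols"
begin

definition arrival_rank :: "(nat \<Rightarrow> int) \<Rightarrow> nat \<Rightarrow> nat" where
  "arrival_rank \<pi> i = nat \<bar>\<pi> i\<bar>"

definition signed_perms :: "nat \<Rightarrow> (nat \<Rightarrow> int) set" where
  "signed_perms n =
     {\<pi> \<in> {1..n} \<rightarrow>\<^sub>E UNIV. bij_betw (arrival_rank \<pi>) {1..n} {1..n}}"

text \<open>A negative entry means that the guest prefers the left napkin, a positive one the right.\<close>

definition neg_count :: "nat \<Rightarrow> (nat \<Rightarrow> int) \<Rightarrow> nat" where
  "neg_count n \<pi> = card {i \<in> {1..n}. \<pi> i < 0}"

definition pos_count :: "nat \<Rightarrow> (nat \<Rightarrow> int) \<Rightarrow> nat" where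
  "pos_count n \<pi> = card {i \<in> {1..n}. \<pi> i > 0}"

definition place_of_rank :: "nat \<Rightarrow> (nat \<Rightarrow> int) \<Rightarrow> nat \<Rightarrow> nat" where
  "place_of_rank n \<pi> k = inv_into {1..n} (arrival_rank \<pi>) k"

text \<open>Napkins are labelled by the place to whose left they lie, so napkin \<open>i\<close> lies between
  places \<open>i - 1\<close> and \<open>i\<close> (cyclically), and the right napkin of place \<open>n\<close> is napkin \<open>1\<close>.\<close>

definition left_napkin :: "nat \<Rightarrow> nat" where
  "left_napkin i = i"

definition right_napkin :: "nat \<Rightarrow> nat \<Rightarrow> nat" where
  "right_napkin n i = (if i = n then 1 else i + 1)"

definition preferred_napkin :: "nat \<Rightarrow> (nat \<Rightarrow> int) \<Rightarrow> nat \<Rightarrow> nat" where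
  "preferred_napkin n \<pi> i = (if \<pi> i < 0 then left_napkin i else right_napkin n i)"

definition other_napkin :: "nat \<Rightarrow> (nat \<Rightarrow> int) \<Rightarrow> nat \<Rightarrow> nat" where
  "other_napkin n \<pi> i = (if \<pi> i < 0 then right_napkin n i else left_napkin i)"

definition napkin_taken :: "nat \<Rightarrow> (nat \<Rightarrow> int) \<Rightarrow> nat set \<Rightarrow> nat \<Rightarrow> nat option" where
  "napkin_taken n \<pi> A i =
     (if preferred_napkin n \<pi> i \<in> A then Some (preferred_napkin n \<pi> i)
      else if other_napkin n \<pi> i \<in> A then Some (other_napkin n \<pi> i)
      else None)"

text \<open>The set of napkins still available after the first \<open>k\<close> arrivals.\<close>

primrec available :: "nat \<Rightarrow> (nat \<Rightarrow> int) \<Rightarrow> nat \<Rightarrow> nat set" where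
  "available n \<pi> 0 = {1..n}"
| "available n \<pi> (Suc k) =
     available n \<pi> k -
     set_option (napkin_taken n \<pi> (available n \<pi> k) (place_of_rank n \<pi> (Suc k)))"

definition napkinless :: "nat \<Rightarrow> (nat \<Rightarrow> int) \<Rightarrow> nat set" where
  "napkinless n \<pi> =
     {i \<in> {1..n}. napkin_taken n \<pi> (available n \<pi> (arrival_rank \<pi> i - 1)) i = None}"

definition expected_napkinless :: "nat \<Rightarrow> real \<Rightarrow> real" where
  "expected_napkinless n p =
     1 / fact n *
     (\<Sum>\<pi>\<in>signed_perms n.
        p ^ neg_count n \<pi> * (1 - p) ^ pos_count n \<pi> * real (card (napkinless n \<pi>)))"

end

theory Submission
  imports Defs "HOL-Combinatorics.Multiset_Permutations"
begin

text \<open>A guest is napkinless exactly if both adjacent napkins are gone when he arrives. The left napkin of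
  place \<open>i\<close> is gone precisely if some \<open>j \<ge> 1\<close> has the following property: the guest at \<open>i - j\<close>
  prefers right, those at \<open>i - j + 1, \<dots>, i - 1\<close> prefer left, and they arrive in the order
  \<open>i - j, i - j + 1, \<dots>, i\<close>. Then the first of them pushes the next one to the right, who pushes the
  next, and so on. The number \<open>j\<close> is unique, and on the right there is a mirror image with some
  length \<open>m\<close> (\<open>napkinless_iff_chains\<close>). A guest belonging to both chains would have to take both of
  his napkins, hence \<open>j + m < n\<close> (\<open>chains_length\<close>).

  For fixed \<open>i\<close>, \<open>j\<close> and \<open>m\<close>, the pattern prescribes \<open>j\<close> left and \<open>m\<close> right preferences, and
  it requires the ranks on \<open>j + m + 1\<close> places to rise from both sides towards \<open>i\<close>. Merging the two
  sides in \<open>(j + m) choose j\<close> ways, each of probability \<open>1 / fact (j + m + 1)\<close>, gives the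
  probability of this event (\<open>card_permutes_peak\<close>, \<open>weight_of_chains\<close>). Summation over all \<open>j\<close> and
  \<open>m\<close> with \<open>j + m = s\<close> by the binomial theorem, and then over \<open>s\<close> and the places, yields for
  \<open>n \<ge> 2\<close> the exact value (\<open>expected_napkinless_eq\<close>)
  \<open>n * (\<Sum>s=1..<n. (1 - p ^ s - q ^ s) / fact (Suc s))\<close>.

  The series over all \<open>s \<ge> 1\<close> has the sum \<open>(1 - p * exp q) * (1 - q * exp p) / (p * q)\<close>, and
  the omitted terms are bounded by the tail of the exponential series (\<open>partial_sum_asymptotics\<close>).\<close>

section \<open>Counting permutations that are increasing along given lists\<close>

definition ordered_by :: "('a \<Rightarrow> 'b::linorder) \<Rightarrow> 'a list \<Rightarrow> bool" where
  "ordered_by f zs \<longleftrightarrow> sorted_wrt (<) (map f zs)"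

lemma ordered_by_distinct: "ordered_by f zs \<Longrightarrow> distinct zs"
  unfolding ordered_by_def strict_sorted_iff by (simp add: distinct_map)

lemma ordered_by_cong:
  "(\<And>x. x \<in> set zs \<Longrightarrow> f x = g x) \<Longrightarrow> ordered_by f zs \<longleftrightarrow> ordered_by g zs"
  unfolding ordered_by_def using map_cong[of zs zs f g] by metis

lemma ordered_by_filter: "ordered_by f zs \<Longrightarrow> ordered_by f (filter P zs)"
  unfolding ordered_by_def sorted_wrt_map by (rule sorted_wrt_filter)

lemma ordered_by_snoc:
  "ordered_by f (zs @ [x]) \<longleftrightarrow> ordered_by f zs \<and> (\<forall>z\<in>set zs. f z < f x)"
  unfolding ordered_by_def by (auto simp: sorted_wrt_append)

lemma ordered_by_unique:
  assumes "inj_on f (set xs)" "set xs = set ys" "ordered_by f xs" "ordered_by f ys"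
  shows "xs = ys"
  using assms unfolding ordered_by_def strict_sorted_iff
  by (intro map_sorted_distinct_set_unique[of f]) (simp_all add: distinct_map)

lemma ordered_by_exists:
  assumes "finite S" "inj_on f S"
  shows "\<exists>zs. set zs = S \<and> ordered_by f zs"
proof -
  define zs where "zs = map (inv_into S f) (sorted_list_of_set (f ` S))"
  have set: "set zs = S"
    using assms by (simp add: zs_def inv_into_image_cancel)
  have "map f zs = sorted_list_of_set (f ` S)"
    unfolding zs_def map_map using assms by (intro map_idI) (simp add: f_inv_into_f)
  then have "ordered_by f zs"
    unfolding ordered_by_def by simp
  with set show ?thesis by blast
qed

text \<open>The \<open>fact (length zs)\<close> arrangements \<open>ws\<close> of the elements of \<open>zs\<close> split the permutations of \<open>A\<close>
  into classes, according to the arrangement along which a permutation is increasing. A permutation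
  \<open>\<tau>\<close> of these elements that carries \<open>zs\<close> to \<open>ws\<close> induces a bijection \<open>\<sigma> \<mapsto> \<sigma> \<circ> \<tau>\<close> between two
  classes, so all classes have the same size.\<close>
lemma card_permutes_ordered_by:
  fixes A :: "'a::linorder set"
  assumes fin: "finite A" and sub: "set zs \<subseteq> A" and dist: "distinct zs"
  shows "card {\<sigma>. \<sigma> permutes A \<and> ordered_by \<sigma> zs} * fact (length zs) = fact (card A)"
proof -
  let ?C = "\<lambda>ws. {\<sigma>. \<sigma> permutes A \<and> ordered_by \<sigma> ws}"
  let ?P = "permutations_of_set (set zs)"
  have fin_perms: "finite {\<sigma>. \<sigma> permutes A}"
    by (rule finite_permutations[OF fin])
  have same: "card (?C ws) = card (?C zs)" if ws: "ws \<in> ?P" for ws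
  proof -
    have dws: "distinct ws" and sws: "set ws = set zs"
      using ws by (auto dest: permutations_of_setD)
    have len: "length ws = length zs"
      using dws sws dist by (metis distinct_card)
    have b1: "bij_betw (\<lambda>i. zs ! i) {..<length zs} (set zs)"
      using dist by (rule bij_betw_nth) auto
    have b2: "bij_betw (\<lambda>i. ws ! i) {..<length zs} (set zs)"
      using dws by (rule bij_betw_nth) (simp_all add: len sws)
    define g where "g = (\<lambda>x. ws ! (inv_into {..<length zs} (\<lambda>i. zs ! i) x))"
    have g: "bij_betw g (set zs) (set zs)"
      using bij_betw_trans[OF bij_betw_inv_into[OF b1] b2] by (simp add: g_def o_def)
    define \<tau> where "\<tau> = (\<lambda>x. if x \<in> set zs then g x else x)"
    have "bij_betw \<tau> (set zs) (set zs)"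
      using g by (subst bij_betw_cong[of _ _ g]) (auto simp: \<tau>_def)
    then have perm: "\<tau> permutes set zs"
      by (rule bij_imp_permutes) (simp add: \<tau>_def)
    have "g (zs ! i) = ws ! i" if "i < length zs" for i
      using bij_betw_imp_inj_on[OF b1] that by (simp add: g_def inv_into_f_f)
    then have map_\<tau>: "map \<tau> zs = ws"
      by (intro nth_equalityI) (auto simp: len \<tau>_def)
    have \<tau>A: "\<tau> permutes A"
      using perm sub by (rule permutes_subset)
    have "bij_betw (\<lambda>\<sigma>. \<sigma> \<circ> \<tau>) (?C ws) (?C zs)"
    proof (rule bij_betw_byWitness[where f' = "\<lambda>\<sigma>. \<sigma> \<circ> inv \<tau>"])
      have inv: "\<tau> \<circ> inv \<tau> = id" "inv \<tau> \<circ> \<tau> = id"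
        using \<tau>A by (simp_all add: permutes_inv_o)
      show "\<forall>\<sigma>\<in>?C ws. (\<sigma> \<circ> \<tau>) \<circ> inv \<tau> = \<sigma>" "\<forall>\<sigma>\<in>?C zs. (\<sigma> \<circ> inv \<tau>) \<circ> \<tau> = \<sigma>"
        by (simp_all add: comp_assoc inv)
      have "map (inv \<tau>) ws = zs"
        using map_\<tau> inv(2) by (metis list.map_comp list.map_id0 id_apply)
      then show "(\<lambda>\<sigma>. \<sigma> \<circ> inv \<tau>) ` ?C zs \<subseteq> ?C ws"
        using \<tau>A by (auto simp: ordered_by_def permutes_compose permutes_inv simp flip: map_map)
      show "(\<lambda>\<sigma>. \<sigma> \<circ> \<tau>) ` ?C ws \<subseteq> ?C zs"
        using map_\<tau> \<tau>A by (auto simp: ordered_by_def permutes_compose simp flip: map_map)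
    qed
    then show ?thesis by (rule bij_betw_same_card)
  qed
  have "{\<sigma>. \<sigma> permutes A} = (\<Union>ws\<in>?P. ?C ws)"
  proof -
    have "\<exists>ws\<in>?P. ordered_by \<sigma> ws" if "\<sigma> permutes A" for \<sigma>
      using ordered_by_exists[of "set zs" \<sigma>] permutes_inj_on[OF that]
      by (auto intro!: permutations_of_setI ordered_by_distinct)
    then show ?thesis by blast
  qed
  also have "card \<dots> = (\<Sum>ws\<in>?P. card (?C ws))"
  proof (rule card_UN_disjoint)
    show "\<forall>ws\<in>?P. finite (?C ws)"
      using fin_perms by (auto intro: finite_subset[OF _ fin_perms])
    have "ws = ws'" if "ws \<in> ?P" "ws' \<in> ?P" "\<sigma> permutes A" "ordered_by \<sigma> ws" "ordered_by \<sigma> ws'"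
      for ws ws' \<sigma>
      using that ordered_by_unique[of \<sigma> ws ws'] permutes_inj_on[of \<sigma> A]
      by (simp add: permutations_of_set_def)
    then show "\<forall>ws\<in>?P. \<forall>ws'\<in>?P. ws \<noteq> ws' \<longrightarrow> ?C ws \<inter> ?C ws' = {}"
      by blast
  qed simp
  also have "\<dots> = fact (length zs) * card (?C zs)"
    using same dist by (simp add: distinct_card)
  finally show ?thesis
    using card_permutations[OF refl fin] by (simp add: mult.commute)
qed

text \<open>Sorting the union of both lists by the values of \<open>f\<close> gives the shuffle: filtering it by
  membership in \<open>xs\<close> leaves a list with the elements of \<open>xs\<close> along which \<open>f\<close> increases, and this
  list can only be \<open>xs\<close>.\<close>
lemma ordered_by_both_iff_shuffle:
  assumes inj: "inj_on f (set xs \<union> set ys)" and disj: "set xs \<inter> set ys = {}"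
  shows "ordered_by f xs \<and> ordered_by f ys \<longleftrightarrow> (\<exists>zs\<in>shuffles xs ys. ordered_by f zs)"
proof
  assume ord: "ordered_by f xs \<and> ordered_by f ys"
  obtain zs where zs: "set zs = set xs \<union> set ys" "ordered_by f zs"
    using ordered_by_exists[OF _ inj] by auto
  have "filter (\<lambda>z. z \<in> set xs) zs = xs"
    using zs ord inj by (intro ordered_by_unique[of f] ordered_by_filter) (auto simp: inj_on_def)
  moreover have "filter (\<lambda>z. z \<notin> set xs) zs = ys"
    using zs ord inj disj by (intro ordered_by_unique[of f] ordered_by_filter) (auto simp: inj_on_def)
  ultimately have "zs \<in> shuffles xs ys"
    using partition_in_shuffles[of zs "\<lambda>z. z \<in> set xs"] by simp
  with zs(2) show "\<exists>zs\<in>shuffles xs ys. ordered_by f zs" by blast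
next
  assume "\<exists>zs\<in>shuffles xs ys. ordered_by f zs"
  then show "ordered_by f xs \<and> ordered_by f ys"
    using filter_shuffles_disjoint1(1)[OF disj] filter_shuffles_disjoint2(1)[OF disj]
      ordered_by_filter by metis
qed

text \<open>Divided by \<open>fact (card A)\<close>, this is the probability that the ranks in a random order rise along
  \<open>xs\<close> and along \<open>ys\<close> towards a common peak at \<open>x\<close>. The peak comes last in every merged order, so
  the merged orders are the shuffles of \<open>xs\<close> and \<open>ys\<close> followed by \<open>x\<close>. They are mutually exclusive
  and equally likely.\<close>
lemma card_permutes_peak:
  fixes A :: "'a::linorder set"
  assumes fin: "finite A" and sub: "set (xs @ ys @ [x]) \<subseteq> A" and dist: "distinct (xs @ ys @ [x])"
  shows "real (card {\<sigma>. \<sigma> permutes A \<and> ordered_by \<sigma> (xs @ [x]) \<and> ordered_by \<sigma> (ys @ [x])}) =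
    fact (card A) * real ((length xs + length ys) choose length xs) / fact (length xs + length ys + 1)"
proof -
  let ?C = "\<lambda>zs. {\<sigma>. \<sigma> permutes A \<and> ordered_by \<sigma> (zs @ [x])}"
  have fin_perms: "finite {\<sigma>. \<sigma> permutes A}"
    by (rule finite_permutations[OF fin])
  have disj: "set xs \<inter> set ys = {}" using dist by auto
  have inj: "inj_on \<sigma> B" if "\<sigma> permutes A" for \<sigma> B
    using that by (rule permutes_inj_on)
  have shuffle: "set zs = set xs \<union> set ys" "distinct zs" "length zs = length xs + length ys"
    if "zs \<in> shuffles xs ys" for zs
    using that dist disj by (auto simp: set_shuffles length_shuffles intro: distinct_disjoint_shuffles)
  have "{\<sigma>. \<sigma> permutes A \<and> ordered_by \<sigma> (xs @ [x]) \<and> ordered_by \<sigma> (ys @ [x])}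
      = (\<Union>zs\<in>shuffles xs ys. ?C zs)"
    using ordered_by_both_iff_shuffle[OF inj disj] shuffle(1)
    unfolding ordered_by_snoc by fastforce
  also have "card \<dots> = (\<Sum>zs\<in>shuffles xs ys. card (?C zs))"
  proof (rule card_UN_disjoint)
    show "\<forall>zs\<in>shuffles xs ys. finite (?C zs)"
      using fin_perms by (auto intro: finite_subset[OF _ fin_perms])
    have "zs = zs'" if "zs \<in> shuffles xs ys" "zs' \<in> shuffles xs ys"
      "\<sigma> permutes A" "ordered_by \<sigma> (zs @ [x])" "ordered_by \<sigma> (zs' @ [x])" for zs zs' \<sigma>
      using that ordered_by_unique[of \<sigma> zs zs'] inj[of \<sigma>]
      by (simp add: shuffle(1) ordered_by_snoc)
    then show "\<forall>zs\<in>shuffles xs ys. \<forall>zs'\<in>shuffles xs ys. zs \<noteq> zs' \<longrightarrow> ?C zs \<inter> ?C zs' = {}"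
      by blast
  qed simp
  finally have "real (card {\<sigma>. \<sigma> permutes A \<and> ordered_by \<sigma> (xs @ [x]) \<and> ordered_by \<sigma> (ys @ [x])})
      = (\<Sum>zs\<in>shuffles xs ys. real (card (?C zs)))" by simp
  also have "\<dots> = (\<Sum>zs\<in>shuffles xs ys. fact (card A) / fact (length xs + length ys + 1))"
  proof (rule sum.cong)
    fix zs assume zs: "zs \<in> shuffles xs ys"
    have "card (?C zs) * fact (length (zs @ [x])) = fact (card A)"
      using shuffle[OF zs] sub dist by (intro card_permutes_ordered_by fin) auto
    from arg_cong[OF this, of real]
    have "real (card (?C zs)) * fact (length (zs @ [x])) = fact (card A)"
      by (simp only: of_nat_fact of_nat_mult)
    moreover have "length (zs @ [x]) = length xs + length ys + 1"
      using shuffle(3)[OF zs] by simp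
    ultimately have "real (card (?C zs)) * fact (length xs + length ys + 1) = fact (card A)"
      by (simp only:)
    then show "real (card (?C zs)) = fact (card A) / fact (length xs + length ys + 1)"
      by (simp only: nonzero_eq_divide_eq fact_nonzero not_False_eq_True)
  qed simp
  also have "\<dots> = real ((length xs + length ys) choose length xs)
      * (fact (card A) / fact (length xs + length ys + 1))"
    by (simp only: sum_constant card_disjoint_shuffles[OF disj])
  finally show ?thesis by (simp only: mult.commute times_divide_eq_right)
qed

section \<open>Separating ranks from preferences\<close>

definition attach_signs :: "nat \<Rightarrow> (nat \<Rightarrow> nat) \<Rightarrow> nat set \<Rightarrow> nat \<Rightarrow> int" where
  "attach_signs n \<sigma> N = (\<lambda>i\<in>{1..n}. if i \<in> N then - int (\<sigma> i) else int (\<sigma> i))"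

lemma signed_perms_rank:
  assumes "\<pi> \<in> signed_perms n" "i \<in> {1..n}"
  shows "arrival_rank \<pi> i \<in> {1..n}" "\<pi> i \<noteq> 0"
proof -
  show "arrival_rank \<pi> i \<in> {1..n}"
    using assms unfolding signed_perms_def by (auto dest!: bij_betw_apply)
  then show "\<pi> i \<noteq> 0" by (auto simp: arrival_rank_def)
qed

lemma attach_signs_apply:
  assumes "\<sigma> permutes {1..n}" "i \<in> {1..n}"
  shows "arrival_rank (attach_signs n \<sigma> N) i = \<sigma> i"
    and "attach_signs n \<sigma> N i < 0 \<longleftrightarrow> i \<in> N"
    and "attach_signs n \<sigma> N i > 0 \<longleftrightarrow> i \<notin> N"
proof -
  have "\<sigma> i \<in> {1..n}" using assms by (simp only: permutes_in_image)
  then show "arrival_rank (attach_signs n \<sigma> N) i = \<sigma> i"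
    and "attach_signs n \<sigma> N i < 0 \<longleftrightarrow> i \<in> N"
    and "attach_signs n \<sigma> N i > 0 \<longleftrightarrow> i \<notin> N"
    using assms(2) by (auto simp: attach_signs_def arrival_rank_def)
qed

lemma bij_betw_attach_signs:
  "bij_betw (\<lambda>(\<sigma>, N). attach_signs n \<sigma> N) ({\<sigma>. \<sigma> permutes {1..n}} \<times> Pow {1..n}) (signed_perms n)"
proof (rule bij_betw_byWitness[where f' =
      "\<lambda>\<pi>. (\<lambda>i. if i \<in> {1..n} then arrival_rank \<pi> i else i, {i \<in> {1..n}. \<pi> i < 0})"])
  let ?f = "\<lambda>(\<sigma>, N). attach_signs n \<sigma> N"
  let ?g = "\<lambda>\<pi>. (\<lambda>i. if i \<in> {1..n} then arrival_rank \<pi> i else i, {i \<in> {1..n}. \<pi> i < 0})"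
  show "\<forall>a\<in>{\<sigma>. \<sigma> permutes {1..n}} \<times> Pow {1..n}. ?g (?f a) = a"
  proof
    fix a assume "a \<in> {\<sigma>. \<sigma> permutes {1..n}} \<times> Pow {1..n}"
    then obtain \<sigma> N where a: "a = (\<sigma>, N)" and \<sigma>: "\<sigma> permutes {1..n}" and N: "N \<subseteq> {1..n}"
      by blast
    have "(\<lambda>i. if i \<in> {1..n} then arrival_rank (attach_signs n \<sigma> N) i else i) = \<sigma>"
      using attach_signs_apply(1)[OF \<sigma>] permutes_not_in[OF \<sigma>] by (intro ext) metis
    moreover have "{i \<in> {1..n}. attach_signs n \<sigma> N i < 0} = N"
      using attach_signs_apply(2)[OF \<sigma>] N by blast
    ultimately show "?g (?f a) = a" by (simp only: a prod.case)
  qed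
  show "\<forall>\<pi>\<in>signed_perms n. ?f (?g \<pi>) = \<pi>"
  proof
    fix \<pi> assume "\<pi> \<in> signed_perms n"
    then have "\<pi> \<in> {1..n} \<rightarrow>\<^sub>E UNIV" by (simp add: signed_perms_def)
    then have "\<pi> i = undefined" if "i \<notin> {1..n}" for i
      using that by (rule PiE_arb)
    then show "?f (?g \<pi>) = \<pi>"
      by (intro ext) (simp add: attach_signs_def arrival_rank_def restrict_def)
  qed
  show "?f ` ({\<sigma>. \<sigma> permutes {1..n}} \<times> Pow {1..n}) \<subseteq> signed_perms n"
  proof clarify
    fix \<sigma> N assume \<sigma>: "\<sigma> permutes {1..n}"
    have "bij_betw (arrival_rank (attach_signs n \<sigma> N)) {1..n} {1..n}"
      using permutes_imp_bij[OF \<sigma>] attach_signs_apply(1)[OF \<sigma>]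
      by (subst bij_betw_cong[of _ _ \<sigma>]) auto
    then show "attach_signs n \<sigma> N \<in> signed_perms n"
      by (auto simp: signed_perms_def attach_signs_def)
  qed
  show "?g ` signed_perms n \<subseteq> {\<sigma>. \<sigma> permutes {1..n}} \<times> Pow {1..n}"
  proof (rule image_subsetI)
    fix \<pi> assume "\<pi> \<in> signed_perms n"
    then have "bij_betw (arrival_rank \<pi>) {1..n} {1..n}" by (simp add: signed_perms_def)
    then have "bij_betw (\<lambda>i. if i \<in> {1..n} then arrival_rank \<pi> i else i) {1..n} {1..n}"
      by (subst bij_betw_cong[of _ _ "arrival_rank \<pi>"]) auto
    then have "(\<lambda>i. if i \<in> {1..n} then arrival_rank \<pi> i else i) permutes {1..n}"
      by (rule bij_imp_permutes) (rule if_not_P)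
    then show "?g \<pi> \<in> {\<sigma>. \<sigma> permutes {1..n}} \<times> Pow {1..n}"
      by (intro SigmaI CollectI; (assumption | blast))
  qed
qed

text \<open>Prescribing the outcomes of \<open>card U + card V\<close> among independent biased coins has probability
  \<open>p ^ card U * q ^ card V\<close>: expand the product over \<open>A\<close> of the factors \<open>p + q\<close>, after deleting
  one summand in each factor whose outcome is prescribed.\<close>
lemma sum_subsets_between:
  fixes p q :: "'a::comm_ring_1"
  assumes "finite A" "U \<subseteq> A" "V \<subseteq> A" "U \<inter> V = {}" "p + q = 1"
  shows "(\<Sum>N\<in>Pow A. p ^ card N * q ^ card (A - N) * of_bool (U \<subseteq> N \<and> N \<inter> V = {}))
    = p ^ card U * q ^ card V"
proof -
  let ?f = "\<lambda>x. if x \<in> V then 0 else p" and ?g = "\<lambda>x. if x \<in> U then 0 else q"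
  have "(\<Sum>N\<in>Pow A. p ^ card N * q ^ card (A - N) * of_bool (U \<subseteq> N \<and> N \<inter> V = {}))
    = (\<Sum>N\<in>Pow A. (\<Prod>x\<in>N. ?f x) * (\<Prod>x\<in>A - N. ?g x))"
  proof (rule sum.cong)
    fix N assume N: "N \<in> Pow A"
    then have fin: "finite N" "finite (A - N)" using assms(1) by (auto intro: finite_subset)
    show "p ^ card N * q ^ card (A - N) * of_bool (U \<subseteq> N \<and> N \<inter> V = {})
        = (\<Prod>x\<in>N. ?f x) * (\<Prod>x\<in>A - N. ?g x)"
    proof (cases "U \<subseteq> N \<and> N \<inter> V = {}")
      case True
      then have "(\<Prod>x\<in>N. ?f x) = (\<Prod>x\<in>N. p)" "(\<Prod>x\<in>A - N. ?g x) = (\<Prod>x\<in>A - N. q)"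
        by (intro prod.cong; use True in auto)+
      with True show ?thesis by simp
    next
      case False
      then have "(\<exists>x\<in>N. ?f x = 0) \<or> (\<exists>x\<in>A - N. ?g x = 0)"
        using assms(2) by auto
      then have "(\<Prod>x\<in>N. ?f x) = 0 \<or> (\<Prod>x\<in>A - N. ?g x) = 0"
        using prod_zero[OF fin(1), of ?f] prod_zero[OF fin(2), of ?g] by blast
      with False show ?thesis by auto
    qed
  qed simp
  also have "\<dots> = (\<Prod>x\<in>A. ?f x + ?g x)"
    by (rule prod_add[OF assms(1), symmetric])
  also have "\<dots> = (\<Prod>x\<in>A. (if x \<in> U then p else 1) * (if x \<in> V then q else 1))"
    using assms(4,5) by (intro prod.cong) auto
  also have "\<dots> = p ^ card U * q ^ card V"
    using assms(1-3) by (simp add: prod.distrib Int_absorb1 flip: prod.inter_restrict)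
  finally show ?thesis .
qed

text \<open>Order of arrival and preferences are independent, so an event that combines a condition on the
  ranks with prescribed preferences factorises. The hypothesis on \<open>Q\<close> reflects that a signed
  permutation determines the ranks on \<open>{1..n}\<close> only.\<close>
lemma weighted_sum_pattern:
  fixes p q :: "'a::comm_ring_1"
  assumes "U \<subseteq> {1..n}" "V \<subseteq> {1..n}" "U \<inter> V = {}" "p + q = 1"
    and cong: "\<And>f g. (\<And>i. i \<in> {1..n} \<Longrightarrow> f i = g i) \<Longrightarrow> Q f \<longleftrightarrow> Q g"
  shows "(\<Sum>\<pi>\<in>signed_perms n. p ^ neg_count n \<pi> * q ^ pos_count n \<pi> *
      of_bool (Q (arrival_rank \<pi>) \<and> (\<forall>i\<in>U. \<pi> i < 0) \<and> (\<forall>i\<in>V. \<pi> i > 0)))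
    = of_nat (card {\<sigma>. \<sigma> permutes {1..n} \<and> Q \<sigma>}) * p ^ card U * q ^ card V"
proof -
  let ?S = "{\<sigma>. \<sigma> permutes {1..n}}"
  let ?t = "\<lambda>\<pi>. p ^ neg_count n \<pi> * q ^ pos_count n \<pi> *
      of_bool (Q (arrival_rank \<pi>) \<and> (\<forall>i\<in>U. \<pi> i < 0) \<and> (\<forall>i\<in>V. \<pi> i > 0))"
  have summand: "?t (attach_signs n \<sigma> N) = of_bool (Q \<sigma>) *
      (p ^ card N * q ^ card ({1..n} - N) * of_bool (U \<subseteq> N \<and> N \<inter> V = {}))"
    if \<sigma>: "\<sigma> permutes {1..n}" and N: "N \<subseteq> {1..n}" for \<sigma> N
  proof -
    have "{i \<in> {1..n}. attach_signs n \<sigma> N i < 0} = N"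
      "{i \<in> {1..n}. attach_signs n \<sigma> N i > 0} = {1..n} - N"
      using attach_signs_apply(2,3)[OF \<sigma>] N by blast+
    moreover have "(\<forall>i\<in>U. attach_signs n \<sigma> N i < 0) \<longleftrightarrow> U \<subseteq> N"
      "(\<forall>i\<in>V. attach_signs n \<sigma> N i > 0) \<longleftrightarrow> N \<inter> V = {}"
      using attach_signs_apply(2,3)[OF \<sigma>] assms(1,2) by blast+
    moreover have "Q (arrival_rank (attach_signs n \<sigma> N)) \<longleftrightarrow> Q \<sigma>"
      by (rule cong) (rule attach_signs_apply(1)[OF \<sigma>])
    ultimately show ?thesis by (simp add: neg_count_def pos_count_def)
  qed
  have "(\<Sum>\<pi>\<in>signed_perms n. ?t \<pi>) = (\<Sum>(\<sigma>, N)\<in>?S \<times> Pow {1..n}. ?t (attach_signs n \<sigma> N))"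
    using sum.reindex_bij_betw[OF bij_betw_attach_signs, of ?t n] by (simp add: case_prod_unfold)
  also have "\<dots> = (\<Sum>\<sigma>\<in>?S. \<Sum>N\<in>Pow {1..n}. ?t (attach_signs n \<sigma> N))"
    by (rule sum.cartesian_product[symmetric])
  also have "\<dots> = (\<Sum>\<sigma>\<in>?S. \<Sum>N\<in>Pow {1..n}. of_bool (Q \<sigma>) *
      (p ^ card N * q ^ card ({1..n} - N) * of_bool (U \<subseteq> N \<and> N \<inter> V = {})))"
    by (intro sum.cong refl summand) auto
  also have "\<dots> = (\<Sum>\<sigma>\<in>?S. of_bool (Q \<sigma>) * (p ^ card U * q ^ card V))"
    using assms(1-4) by (simp only: sum_subsets_between finite_atLeastAtMost flip: sum_distrib_left)
  also have "\<dots> = of_nat (card {\<sigma>. \<sigma> permutes {1..n} \<and> Q \<sigma>}) * p ^ card U * q ^ card V"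
    by (simp add: finite_permutations Int_def mult.assoc flip: sum_distrib_right)
  finally show ?thesis .
qed

section \<open>Places relative to a given place\<close>

text \<open>The place that is \<open>k\<close> steps to the right of place \<open>i\<close>; the shifts by one account for places being
  numbered from \<open>1\<close>. Signed steps allow both directions to be treated at once.\<close>
definition seat :: "nat \<Rightarrow> nat \<Rightarrow> int \<Rightarrow> nat" where
  "seat n i k = nat ((int i - 1 + k) mod int n) + 1"

lemma seat_in_range: "n \<ge> 1 \<Longrightarrow> seat n i k \<in> {1..n}"
  by (auto simp: seat_def Suc_le_eq nat_less_iff)

lemma seat_0: "i \<in> {1..n} \<Longrightarrow> seat n i 0 = i"
  by (auto simp: seat_def)

lemma int_seat: "n \<ge> 1 \<Longrightarrow> int (seat n i k) = (int i - 1 + k) mod int n + 1"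
  by (simp add: seat_def)

lemma seat_seat: "n \<ge> 1 \<Longrightarrow> seat n (seat n i k) l = seat n i (k + l)"
  unfolding seat_def[of n "seat n i k" l]
  by (simp add: int_seat mod_simps) (simp add: seat_def algebra_simps)

lemma seat_eq_iff:
  assumes "n \<ge> 1"
  shows "seat n i k = seat n i l \<longleftrightarrow> int n dvd k - l"
proof -
  have "seat n i k = seat n i l \<longleftrightarrow> (int i - 1 + k) mod int n = (int i - 1 + l) mod int n"
    using int_seat[OF assms, of i k] int_seat[OF assms, of i l] by auto
  also have "\<dots> \<longleftrightarrow> int n dvd k - l"
    by (simp add: mod_eq_dvd_iff)
  finally show ?thesis .
qed

lemma inj_on_seat:
  assumes "n \<ge> 1" "b - a < int n"
  shows "inj_on (seat n i) {a..b}"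
proof (rule inj_onI)
  fix k l assume kl: "k \<in> {a..b}" "l \<in> {a..b}" "seat n i k = seat n i l"
  then have "int n dvd k - l" using assms(1) by (simp add: seat_eq_iff)
  moreover have "\<bar>k - l\<bar> < int n" using kl assms(2) by auto
  ultimately show "k = l"
    using zdvd_imp_le[of "int n" "\<bar>k - l\<bar>"] by (cases "k = l") auto
qed

lemma seat_1: "i \<in> {1..n} \<Longrightarrow> seat n i 1 = right_napkin n i"
  by (auto simp: seat_def right_napkin_def)

lemma right_napkin_eq_iff:
  assumes "n \<ge> 1" "i \<in> {1..n}" "g \<in> {1..n}"
  shows "right_napkin n g = i \<longleftrightarrow> g = seat n i (- 1)"
proof
  assume "right_napkin n g = i"
  then have "i = seat n g 1" using assms by (simp add: seat_1)
  then show "g = seat n i (- 1)"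
    using assms by (simp add: seat_seat seat_0)
next
  assume "g = seat n i (- 1)"
  then show "right_napkin n g = i"
    using assms by (simp add: seat_seat seat_0 flip: seat_1)
qed

section \<open>When a napkin is gone\<close>

definition obtained :: "nat \<Rightarrow> (nat \<Rightarrow> int) \<Rightarrow> nat \<Rightarrow> nat option" where
  "obtained n \<pi> i = napkin_taken n \<pi> (available n \<pi> (arrival_rank \<pi> i - 1)) i"

lemma obtained_adjacent:
  "obtained n \<pi> g = Some x \<Longrightarrow> x = g \<or> x = right_napkin n g"
  by (auto simp: obtained_def napkin_taken_def preferred_napkin_def other_napkin_def
      left_napkin_def split: if_splits)

text \<open>The sets of available napkins are defined by recursion on time. This replaces them by
  a static description in terms of who got which napkin.\<close>
lemma not_available_iff:
  assumes \<pi>: "\<pi> \<in> signed_perms n" and "k \<le> n" and x: "x \<in> {1..n}"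
  shows "x \<notin> available n \<pi> k \<longleftrightarrow> (\<exists>g\<in>{1..n}. arrival_rank \<pi> g \<le> k \<and> obtained n \<pi> g = Some x)"
  using \<open>k \<le> n\<close>
proof (induction k)
  case 0
  show ?case using x signed_perms_rank(1)[OF \<pi>] by fastforce
next
  case (Suc k)
  have bij: "bij_betw (arrival_rank \<pi>) {1..n} {1..n}"
    using \<pi> by (simp add: signed_perms_def)
  define h where "h = place_of_rank n \<pi> (Suc k)"
  have "Suc k \<in> arrival_rank \<pi> ` {1..n}"
    using bij Suc.prems by (simp add: bij_betw_imp_surj_on)
  then have h: "h \<in> {1..n}" "arrival_rank \<pi> h = Suc k"
    unfolding h_def place_of_rank_def by (rule inv_into_into, rule f_inv_into_f)
  have uniq: "g = h" if "g \<in> {1..n}" "arrival_rank \<pi> g = Suc k" for g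
    using bij_betw_imp_inj_on[OF bij] h that by (metis inj_onD)
  have "x \<notin> available n \<pi> (Suc k) \<longleftrightarrow> x \<notin> available n \<pi> k \<or> obtained n \<pi> h = Some x"
    unfolding available.simps h_def[symmetric] obtained_def h(2) by (auto simp: elem_set)
  also have "\<dots> \<longleftrightarrow> (\<exists>g\<in>{1..n}. arrival_rank \<pi> g \<le> Suc k \<and> obtained n \<pi> g = Some x)"
    unfolding Suc.IH[OF Suc_leD[OF Suc.prems]] le_Suc_eq using h uniq by blast
  finally show ?case .
qed

lemma gone_iff_obtained_before:
  assumes \<pi>: "\<pi> \<in> signed_perms n" and "i \<in> {1..n}" "x \<in> {1..n}"
  shows "x \<notin> available n \<pi> (arrival_rank \<pi> i - 1) \<longleftrightarrow>
    (\<exists>g\<in>{1..n}. arrival_rank \<pi> g < arrival_rank \<pi> i \<and> obtained n \<pi> g = Some x)"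
proof -
  have "arrival_rank \<pi> i \<in> {1..n}"
    by (rule signed_perms_rank(1)[OF \<pi> assms(2)])
  then have "a \<le> arrival_rank \<pi> i - 1 \<longleftrightarrow> a < arrival_rank \<pi> i" "arrival_rank \<pi> i - 1 \<le> n" for a
    by auto
  then show ?thesis
    using not_available_iff[OF \<pi> _ assms(3), of "arrival_rank \<pi> i - 1"] by (simp only:)
qed

definition left_gone :: "nat \<Rightarrow> (nat \<Rightarrow> int) \<Rightarrow> nat \<Rightarrow> bool" where
  "left_gone n \<pi> i \<longleftrightarrow> left_napkin i \<notin> available n \<pi> (arrival_rank \<pi> i - 1)"

definition right_gone :: "nat \<Rightarrow> (nat \<Rightarrow> int) \<Rightarrow> nat \<Rightarrow> bool" where
  "right_gone n \<pi> i \<longleftrightarrow> right_napkin n i \<notin> available n \<pi> (arrival_rank \<pi> i - 1)"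

lemma napkinless_iff:
  "i \<in> napkinless n \<pi> \<longleftrightarrow> i \<in> {1..n} \<and> left_gone n \<pi> i \<and> right_gone n \<pi> i"
  by (auto simp: napkinless_def napkin_taken_def preferred_napkin_def other_napkin_def
      left_gone_def right_gone_def)

lemma obtained_right_iff:
  assumes "n \<ge> 2" "g \<in> {1..n}"
  shows "obtained n \<pi> g = Some (right_napkin n g) \<longleftrightarrow>
    \<not> right_gone n \<pi> g \<and> (\<not> \<pi> g < 0 \<or> left_gone n \<pi> g)"
proof -
  have "right_napkin n g \<noteq> g" using assms by (auto simp: right_napkin_def)
  then show ?thesis
    by (auto simp: obtained_def napkin_taken_def preferred_napkin_def other_napkin_def
        left_gone_def right_gone_def left_napkin_def)
qed

lemma obtained_left_iff:
  assumes "n \<ge> 2" "g \<in> {1..n}"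
  shows "obtained n \<pi> g = Some g \<longleftrightarrow> \<not> left_gone n \<pi> g \<and> (\<pi> g < 0 \<or> right_gone n \<pi> g)"
proof -
  have "right_napkin n g \<noteq> g" using assms by (auto simp: right_napkin_def)
  then show ?thesis
    by (auto simp: obtained_def napkin_taken_def preferred_napkin_def other_napkin_def
        left_gone_def right_gone_def left_napkin_def)
qed

text \<open>Only the guest at \<open>i\<close> and the left neighbour \<open>l\<close> have access to the left napkin of \<open>i\<close>.
  If \<open>l\<close> arrives before \<open>i\<close>, this napkin is still free at that time, so \<open>l\<close> takes it exactly if
  \<open>l\<close> prefers it or is forced to take it because the left napkin of \<open>l\<close> is gone.\<close>
lemma left_gone_step:
  assumes n: "n \<ge> 2" and \<pi>: "\<pi> \<in> signed_perms n" and i: "i \<in> {1..n}"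
  defines "l \<equiv> seat n i (- 1)"
  shows "left_gone n \<pi> i \<longleftrightarrow> arrival_rank \<pi> l < arrival_rank \<pi> i \<and> (\<pi> l > 0 \<or> left_gone n \<pi> l)"
proof -
  have l: "l \<in> {1..n}" using n by (simp only: l_def seat_in_range)
  have rl: "right_napkin n l = i"
    using n i l right_napkin_eq_iff[of n i l] by (simp add: l_def)
  have only: "g = i \<or> g = l" if "g \<in> {1..n}" "obtained n \<pi> g = Some i" for g
    using obtained_adjacent[OF that(2)] right_napkin_eq_iff[of n i g] n i that(1)
    by (auto simp: l_def)
  have "left_gone n \<pi> i \<longleftrightarrow> arrival_rank \<pi> l < arrival_rank \<pi> i \<and> obtained n \<pi> l = Some i"
    unfolding left_gone_def left_napkin_def gone_iff_obtained_before[OF \<pi> i i]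
    using only l by blast
  moreover have "\<not> right_gone n \<pi> l" if "arrival_rank \<pi> l < arrival_rank \<pi> i"
    unfolding right_gone_def rl gone_iff_obtained_before[OF \<pi> l i]
    using only that by fastforce
  moreover have "\<pi> l \<noteq> 0" by (rule signed_perms_rank(2)[OF \<pi> l])
  ultimately show ?thesis
    using obtained_right_iff[OF n l, of \<pi>] unfolding rl by auto
qed

lemma right_gone_step:
  assumes n: "n \<ge> 2" and \<pi>: "\<pi> \<in> signed_perms n" and i: "i \<in> {1..n}"
  defines "r \<equiv> seat n i 1"
  shows "right_gone n \<pi> i \<longleftrightarrow> arrival_rank \<pi> r < arrival_rank \<pi> i \<and> (\<pi> r < 0 \<or> right_gone n \<pi> r)"
proof -
  have r: "r \<in> {1..n}" using n by (simp only: r_def seat_in_range)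
  have ri: "right_napkin n i = r" using i by (simp add: r_def seat_1)
  have only: "g = i \<or> g = r" if "g \<in> {1..n}" "obtained n \<pi> g = Some r" for g
    using obtained_adjacent[OF that(2)] right_napkin_eq_iff[of n r g]
      right_napkin_eq_iff[of n r i] n i r that(1) ri by auto
  have "right_gone n \<pi> i \<longleftrightarrow> arrival_rank \<pi> r < arrival_rank \<pi> i \<and> obtained n \<pi> r = Some r"
    unfolding right_gone_def ri gone_iff_obtained_before[OF \<pi> i r]
    using only r by blast
  moreover have "\<not> left_gone n \<pi> r" if "arrival_rank \<pi> r < arrival_rank \<pi> i"
    unfolding left_gone_def left_napkin_def gone_iff_obtained_before[OF \<pi> r r]
    using only that by fastforce
  ultimately show ?thesis
    using obtained_left_iff[OF n r, of \<pi>] by auto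
qed

section \<open>Chains of arrivals\<close>

text \<open>A chain explains why the napkin of place \<open>i\<close> in direction \<open>d\<close> (\<open>-1\<close> for left, \<open>1\<close> for right) is
  gone. The guest \<open>j\<close> steps away comes first and takes, by preference, the napkin on the side of
  \<open>i\<close>; then, one after the other, the guests in between prefer the napkin on the side away from
  \<open>i\<close>, find it taken and use the one on the side of \<open>i\<close>. Since negative entries prefer left,
  \<open>d * \<pi> k > 0\<close> says that the guest at \<open>k\<close> prefers direction \<open>d\<close>.\<close>
definition chain :: "nat \<Rightarrow> (nat \<Rightarrow> int) \<Rightarrow> int \<Rightarrow> nat \<Rightarrow> nat \<Rightarrow> bool" where
  "chain n \<pi> d i j \<longleftrightarrow> 1 \<le> j \<and>
     (\<forall>a<j. arrival_rank \<pi> (seat n i (d * int (Suc a))) < arrival_rank \<pi> (seat n i (d * int a))) \<and>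
     (\<forall>a\<in>{1..<j}. 0 < d * \<pi> (seat n i (d * int a))) \<and>
     d * \<pi> (seat n i (d * int j)) < 0"

lemma chain_Suc:
  fixes d :: int
  assumes i: "i \<in> {1..n}"
  defines "s \<equiv> seat n i d"
  shows "chain n \<pi> d i (Suc j) \<longleftrightarrow> arrival_rank \<pi> s < arrival_rank \<pi> i \<and>
    (if j = 0 then d * \<pi> s < 0 else 0 < d * \<pi> s \<and> chain n \<pi> d s j)"
proof -
  have shift: "seat n s (d * int a) = seat n i (d * int (Suc a))" for a
    using i by (simp add: s_def seat_seat algebra_simps)
  show ?thesis
  proof (cases "j = 0")
    case True
    then show ?thesis using i by (simp add: chain_def s_def seat_0)
  next
    case False
    have "(\<forall>a\<in>{1..<Suc j}. P a) \<longleftrightarrow> P 1 \<and> (\<forall>a\<in>{1..<j}. P (Suc a))" for P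
    proof -
      have "{1..<Suc j} = insert 1 (Suc ` {1..<j})"
        using False by (auto simp: image_Suc_atLeastLessThan)
      then show ?thesis by (simp only: ball_simps)
    qed
    moreover have "(\<forall>a<Suc j. P a) \<longleftrightarrow> P 0 \<and> (\<forall>a<j. P (Suc a))" for P
      by (rule All_less_Suc2)
    moreover have "seat n i (d * int 0) = i" "seat n i (d * int 1) = s" "seat n i (d * int (Suc 0)) = s"
      using i by (simp_all add: s_def seat_0)
    ultimately show ?thesis
      using False unfolding chain_def shift by auto
  qed
qed

text \<open>Unfolding the one-step description of \<open>gone\<close> ends because the ranks decrease along the way. The
  statement is abstract in \<open>gone\<close> and \<open>d\<close> so that it covers both sides.\<close>
lemma gone_iff_chain:
  assumes step: "\<And>i. i \<in> {1..n} \<Longrightarrow> gone i \<longleftrightarrow>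
      arrival_rank \<pi> (seat n i d) < arrival_rank \<pi> i \<and> (d * \<pi> (seat n i d) < 0 \<or> gone (seat n i d))"
    and nz: "\<And>i. i \<in> {1..n} \<Longrightarrow> d * \<pi> i \<noteq> 0"
    and i: "i \<in> {1..n}"
  shows "gone i \<longleftrightarrow> (\<exists>j. chain n \<pi> d i j)"
  using i
proof (induction "arrival_rank \<pi> i" arbitrary: i rule: less_induct)
  case less
  let ?s = "seat n i d"
  have s: "?s \<in> {1..n}" using less.prems by (intro seat_in_range) auto
  have "(\<exists>j. chain n \<pi> d i j) \<longleftrightarrow> (\<exists>j. chain n \<pi> d i (Suc j))"
    by (metis chain_def not_one_le_zero not0_implies_Suc)
  also have "\<dots> \<longleftrightarrow> arrival_rank \<pi> ?s < arrival_rank \<pi> i \<and>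
      (d * \<pi> ?s < 0 \<or> (0 < d * \<pi> ?s \<and> (\<exists>j. chain n \<pi> d ?s j)))"
    unfolding chain_Suc[OF less.prems] by (metis chain_def not_one_le_zero)
  also have "\<dots> \<longleftrightarrow> gone i"
    using less.hyps[OF _ s] step[OF less.prems] nz[OF s] by (metis linorder_neqE)
  finally show ?case by simp
qed

text \<open>The preference of the guest at the end of a chain differs from those in its interior.\<close>
lemma chain_unique:
  assumes "chain n \<pi> d i j" "chain n \<pi> d i j'"
  shows "j = j'"
proof -
  have "\<not> j < j'" if "chain n \<pi> d i j" "chain n \<pi> d i j'" for j j'
  proof
    assume "j < j'"
    then have "j \<in> {1..<j'}" using that(1) by (simp add: chain_def)
    then show False using that unfolding chain_def by (meson less_asym)
  qed
  then show ?thesis using assms by (meson linorder_neqE_nat)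
qed

lemma chain_length:
  assumes \<pi>: "\<pi> \<in> signed_perms n" and i: "i \<in> {1..n}" and chain: "chain n \<pi> d i j"
  shows "j < n"
proof -
  have "arrival_rank \<pi> (seat n i (d * int a)) + a \<le> arrival_rank \<pi> i" if "a \<le> j" for a
    using that
  proof (induction a)
    case (Suc a)
    then have "arrival_rank \<pi> (seat n i (d * int (Suc a))) < arrival_rank \<pi> (seat n i (d * int a))"
      using chain by (simp add: chain_def)
    then show ?case using Suc by simp
  qed (use i in \<open>simp add: seat_0\<close>)
  from this[of j] have "arrival_rank \<pi> (seat n i (d * int j)) + j \<le> arrival_rank \<pi> i" by simp
  moreover have "1 \<le> arrival_rank \<pi> (seat n i (d * int j))"
    using signed_perms_rank(1)[OF \<pi> seat_in_range] i by simp
  moreover have "arrival_rank \<pi> i \<le> n" using signed_perms_rank(1)[OF \<pi> i] by simp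
  ultimately show ?thesis by simp
qed

text \<open>The guest at the far end of the left chain prefers right and arrives before the guest next on the
  right. The guest at the far end of the right chain prefers left, and every other guest of the
  right chain arrives after the guest next on the right. So the far end of the left chain is not on
  the right chain, as would be the case if both chains together went all the way around the table.\<close>
lemma chains_length:
  assumes \<pi>: "\<pi> \<in> signed_perms n" and i: "i \<in> {1..n}"
    and left: "chain n \<pi> (- 1) i j" and right: "chain n \<pi> 1 i m"
  shows "j + m < n"
proof (rule ccontr)
  assume "\<not> j + m < n"
  \<comment> \<open>Going \<open>j\<close> places to the left leads to the same place as going \<open>n - j\<close> places to the right.\<close>
  moreover define b where "b = n - j"
  moreover have "j < n" by (rule chain_length[OF \<pi> i left])
  moreover have "1 \<le> j" using left by (simp add: chain_def)
  ultimately have b: "1 \<le> b" "b \<le> m" "int b = int n - int j" by auto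
  have meet: "seat n i (int b) = seat n i (- int j)"
    "seat n i (int (Suc b)) = seat n i (- int (j - 1))"
    using i b \<open>1 \<le> j\<close> by (simp_all add: seat_eq_iff of_nat_diff)
  have pos: "\<pi> (seat n i (- int j)) > 0" using left by (simp add: chain_def)
  have "b \<noteq> m"
  proof
    assume "b = m"
    then have "\<pi> (seat n i (int b)) < 0" using right by (simp add: chain_def)
    with pos meet(1) show False by simp
  qed
  then have "arrival_rank \<pi> (seat n i (int (Suc b))) < arrival_rank \<pi> (seat n i (int b))"
    using right b(2) by (simp add: chain_def)
  moreover have "arrival_rank \<pi> (seat n i (- int (Suc (j - 1)))) < arrival_rank \<pi> (seat n i (- int (j - 1)))"
  proof -
    have "j - 1 < j" using \<open>1 \<le> j\<close> by simp
    then show ?thesis using left unfolding chain_def mult_minus1 by blast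
  qed
  ultimately show False using meet \<open>1 \<le> j\<close> by simp
qed

lemma napkinless_iff_chains:
  assumes n: "n \<ge> 2" and \<pi>: "\<pi> \<in> signed_perms n" and i: "i \<in> {1..n}"
  shows "i \<in> napkinless n \<pi> \<longleftrightarrow> (\<exists>j. chain n \<pi> (- 1) i j) \<and> (\<exists>m. chain n \<pi> 1 i m)"
proof -
  have nz: "\<pi> k \<noteq> 0" if "k \<in> {1..n}" for k
    by (rule signed_perms_rank(2)[OF \<pi> that])
  have "left_gone n \<pi> i \<longleftrightarrow> (\<exists>j. chain n \<pi> (- 1) i j)"
    using left_gone_step[OF n \<pi>] nz by (intro gone_iff_chain[OF _ _ i]) simp_all
  moreover have "right_gone n \<pi> i \<longleftrightarrow> (\<exists>m. chain n \<pi> 1 i m)"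
    using right_gone_step[OF n \<pi>] nz by (intro gone_iff_chain[OF _ _ i]) simp_all
  ultimately show ?thesis using i by (simp add: napkinless_iff)
qed

text \<open>By uniqueness of chains, at most one term of the double sum is nonzero. The total length \<open>s\<close> of
  both chains is the outer index since the terms with equal \<open>s\<close> add up by the binomial theorem.\<close>
lemma of_bool_napkinless:
  assumes n: "n \<ge> 2" and \<pi>: "\<pi> \<in> signed_perms n" and i: "i \<in> {1..n}"
  shows "of_bool (i \<in> napkinless n \<pi>) = (\<Sum>s\<in>{1..<n}. \<Sum>j\<in>{1..<s}.
    of_bool (chain n \<pi> (- 1) i j \<and> chain n \<pi> 1 i (s - j)) :: real)"
proof (cases "i \<in> napkinless n \<pi>")
  case False
  then have "\<not> (chain n \<pi> (- 1) i j \<and> chain n \<pi> 1 i m)" for j m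
    using napkinless_iff_chains[OF n \<pi> i] by blast
  with False show ?thesis by (simp only: of_bool_eq sum.neutral_const)
next
  case True
  then obtain j0 m0 where ch: "chain n \<pi> (- 1) i j0" "chain n \<pi> 1 i m0"
    using napkinless_iff_chains[OF n \<pi> i] by blast
  define s0 where "s0 = j0 + m0"
  have "j0 \<ge> 1" "m0 \<ge> 1" using ch by (simp_all add: chain_def)
  then have mem: "s0 \<in> {1..<n}" "j0 \<in> {1..<s0}"
    using chains_length[OF \<pi> i ch] by (auto simp: s0_def)
  have eq: "(chain n \<pi> (- 1) i j \<and> chain n \<pi> 1 i (s - j)) \<longleftrightarrow> j = j0 \<and> s = s0"
    if "j \<in> {1..<s}" for s j
  proof
    assume "chain n \<pi> (- 1) i j \<and> chain n \<pi> 1 i (s - j)"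
    then have "j = j0" "s - j = m0" using ch chain_unique by blast+
    then show "j = j0 \<and> s = s0" using that unfolding s0_def by auto
  qed (use ch in \<open>simp add: s0_def\<close>)
  have "(\<Sum>s\<in>{1..<n}. \<Sum>j\<in>{1..<s}. of_bool (chain n \<pi> (- 1) i j \<and> chain n \<pi> 1 i (s - j)) :: real)
      = (\<Sum>s\<in>{1..<n}. \<Sum>j\<in>{1..<s}. if j = j0 then of_bool (s = s0) else 0)"
    using eq by (intro sum.cong refl) simp
  also have "\<dots> = (\<Sum>s\<in>{1..<n}. if s = s0 then 1 else 0)"
    using mem(2) by (intro sum.cong refl) auto
  also have "\<dots> = 1" using mem(1) by (simp only: sum.delta finite_atLeastLessThan if_True)
  finally show ?thesis using True by simp
qed

section \<open>The weight of a pair of chains\<close>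

text \<open>The guests of a chain of length \<open>j\<close>, farthest first, which is their order of arrival.\<close>
definition path :: "nat \<Rightarrow> int \<Rightarrow> nat \<Rightarrow> nat \<Rightarrow> nat list" where
  "path n d i j = rev (map (\<lambda>a. seat n i (d * int a)) [1..<Suc j])"

lemma ordered_by_rev_upt:
  "ordered_by f (rev (map h [0..<Suc j])) \<longleftrightarrow> (\<forall>a<j. f (h (Suc a)) < f (h a))"
proof (induction j)
  case 0
  show ?case by (simp add: ordered_by_def)
next
  case (Suc j)
  have cons: "rev (map h [0..<Suc k]) = h k # rev (map h [0..<k])" for k by simp
  have "ordered_by f (rev (map h [0..<Suc (Suc j)])) \<longleftrightarrow>
      f (h (Suc j)) < f (h j) \<and> ordered_by f (rev (map h [0..<Suc j]))"
    unfolding cons ordered_by_def list.map by (rule sorted_wrt2) (simp add: transp_on_less)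
  then show ?case unfolding Suc.IH All_less_Suc by blast
qed

lemma ordered_by_path:
  assumes "i \<in> {1..n}"
  shows "ordered_by f (path n d i j @ [i]) \<longleftrightarrow>
    (\<forall>a<j. f (seat n i (d * int (Suc a))) < f (seat n i (d * int a)))"
proof -
  have "path n d i j @ [i] = rev (map (\<lambda>a. seat n i (d * int a)) [0..<Suc j])"
    using assms upt_conv_Cons[of 0 "Suc j"] by (simp add: path_def seat_0 del: upt_Suc)
  then show ?thesis by (simp only: ordered_by_rev_upt)
qed

text \<open>The chains occupy \<open>j + m\<close> distinct places besides \<open>i\<close>. On these, the ranks rise along both sides
  towards \<open>i\<close>, and all preferences are prescribed: \<open>j\<close> of them are left (\<open>j - 1\<close> on the left chain
  and the far end of the right chain), and \<open>m\<close> are right.\<close>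
lemma weight_of_chains:
  fixes p q :: real
  assumes i: "i \<in> {1..n}" and j: "1 \<le> j" and m: "1 \<le> m" and jm: "j + m < n" and pq: "p + q = 1"
  shows "(\<Sum>\<pi>\<in>signed_perms n. p ^ neg_count n \<pi> * q ^ pos_count n \<pi> *
      of_bool (chain n \<pi> (- 1) i j \<and> chain n \<pi> 1 i m))
    = fact n * (real ((j + m) choose j) / fact (j + m + 1)) * (p ^ j * q ^ m)"
proof -
  define Q :: "(nat \<Rightarrow> nat) \<Rightarrow> bool" where
    "Q f \<longleftrightarrow> ordered_by f (path n (- 1) i j @ [i]) \<and> ordered_by f (path n 1 i m @ [i])" for f
  \<comment> \<open>The offsets, relative to \<open>i\<close>, of the guests that have to prefer left and right.\<close>
  define KU KV where "KU = insert (int m) ((\<lambda>a. - int a) ` {1..<j})"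
    and "KV = insert (- int j) (int ` {1..<m})"
  define U V where "U = seat n i ` KU" and "V = seat n i ` KV"
  have n: "n \<ge> 1" using i by simp
  have inj: "inj_on (seat n i) {- int j..int m}"
    using jm by (intro inj_on_seat n) simp
  have KUV: "KU \<subseteq> {- int j..int m}" "KV \<subseteq> {- int j..int m}" "KU \<inter> KV = {}"
    using j m by (auto simp: KU_def KV_def)
  have card: "card U = j" "card V = m"
  proof -
    have "card U = card KU" "card V = card KV"
      unfolding U_def V_def using KUV inj by (auto intro!: card_image inj_on_subset[OF inj])
    moreover have "card KU = Suc (card ((\<lambda>a. - int a) ` {1..<j}))"
      unfolding KU_def using m by (intro card_insert_disjoint) auto
    moreover have "card KV = Suc (card (int ` {1..<m}))"
      unfolding KV_def using j by (intro card_insert_disjoint) auto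
    moreover have "card ((\<lambda>a. - int a) ` {1..<j}) = j - 1" "card (int ` {1..<m}) = m - 1"
      by (simp_all add: card_image inj_on_def)
    ultimately show "card U = j" "card V = m" using j m by simp_all
  qed
  have UV: "U \<inter> V = {}"
    unfolding U_def V_def using inj_on_image_Int[OF inj KUV(1,2)] KUV(3) by simp
  have range: "seat n i k \<in> {1..n}" for k by (rule seat_in_range[OF n])
  then have sub: "U \<subseteq> {1..n}" "V \<subseteq> {1..n}" by (auto simp: U_def V_def)
  have pattern: "chain n \<pi> (- 1) i j \<and> chain n \<pi> 1 i m \<longleftrightarrow>
      Q (arrival_rank \<pi>) \<and> (\<forall>k\<in>U. \<pi> k < 0) \<and> (\<forall>k\<in>V. \<pi> k > 0)" for \<pi>
    unfolding chain_def Q_def ordered_by_path[OF i] U_def V_def KU_def KV_def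
    using j m by auto
  have set: "set (path n (- 1) i j @ path n 1 i m @ [i]) \<subseteq> {1..n}"
    using range i by (auto simp: path_def simp del: upt_Suc)
  have cong: "Q f \<longleftrightarrow> Q g" if "\<And>k. k \<in> {1..n} \<Longrightarrow> f k = g k" for f g
    unfolding Q_def using set that by (intro arg_cong2[of _ _ _ _ "(\<and>)"] ordered_by_cong) auto
  have dist: "distinct (path n (- 1) i j @ path n 1 i m @ [i])"
  proof -
    define ks where "ks = rev (map (\<lambda>a. - int a) [1..<Suc j]) @ rev (map int [1..<Suc m]) @ [0]"
    have "path n (- 1) i j @ path n 1 i m @ [i] = map (seat n i) ks"
      using i by (simp add: ks_def path_def seat_0 rev_map o_def del: upt_Suc)
    moreover have "distinct ks"
      by (auto simp: ks_def distinct_map inj_on_def simp del: upt_Suc)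
    moreover have "set ks \<subseteq> {- int j..int m}"
      by (auto simp: ks_def simp del: upt_Suc)
    ultimately show ?thesis
      using inj_on_subset[OF inj] by (simp only: distinct_map)
  qed
  have len: "length (path n (- 1) i j) = j" "length (path n 1 i m) = m"
    by (simp_all add: path_def del: upt_Suc)
  have "real (card {\<sigma>. \<sigma> permutes {1..n} \<and> Q \<sigma>})
      = fact n * real ((j + m) choose j) / fact (j + m + 1)"
    using card_permutes_peak[OF finite_atLeastAtMost set dist]
    unfolding Q_def len by simp
  then show ?thesis
    unfolding pattern using weighted_sum_pattern[where Q = Q, OF sub UV pq cong]
    by (simp only: card mult.assoc times_divide_eq_right)
qed

section \<open>The expectation\<close>

lemma sum_binomial_inner:
  fixes p q :: real
  assumes "p + q = 1" "s \<ge> 1"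
  shows "(\<Sum>j\<in>{1..<s}. real (s choose j) * p ^ j * q ^ (s - j)) = 1 - p ^ s - q ^ s"
proof -
  have "{..s} = insert 0 (insert s {1..<s})" using assms(2) by auto
  moreover have "(\<Sum>j\<le>s. real (s choose j) * p ^ j * q ^ (s - j)) = 1"
    using binomial_ring[of p q s] assms(1) by simp
  ultimately show ?thesis using assms(2) by simp
qed

text \<open>Linearity of expectation over the places \<open>i\<close> and over the possible pairs of chains at \<open>i\<close>. For \<open>s\<close>
  guests on both chains, the term with \<open>j\<close> of them on the left is \<open>p ^ j * q ^ (s - j)\<close> times
  \<open>s choose j\<close> over \<open>fact (Suc s)\<close>; the values \<open>j = 0\<close> and \<open>j = s\<close>, excluded because both
  chains are nonempty, account for the subtracted powers.\<close>
lemma expected_napkinless_eq: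
  assumes n: "n \<ge> 2" and pq: "p + q = 1"
  shows "expected_napkinless n p = real n * (\<Sum>s\<in>{1..<n}. (1 - p ^ s - q ^ s) / fact (Suc s))"
proof -
  let ?w = "\<lambda>\<pi>. p ^ neg_count n \<pi> * q ^ pos_count n \<pi>"
  let ?c = "\<lambda>\<pi> i s j. of_bool (chain n \<pi> (- 1) i j \<and> chain n \<pi> 1 i (s - j)) :: real"
  have q: "q = 1 - p" using pq by simp
  have inner: "(\<Sum>j\<in>{1..<s}. \<Sum>\<pi>\<in>signed_perms n. ?w \<pi> * ?c \<pi> i s j)
      = fact n * ((1 - p ^ s - q ^ s) / fact (Suc s))"
    if i: "i \<in> {1..n}" and s: "s \<in> {1..<n}" for i s
  proof -
    have "(\<Sum>j\<in>{1..<s}. \<Sum>\<pi>\<in>signed_perms n. ?w \<pi> * ?c \<pi> i s j)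
        = (\<Sum>j\<in>{1..<s}. fact n / fact (Suc s) * (real (s choose j) * p ^ j * q ^ (s - j)))"
    proof (rule sum.cong)
      fix j assume j: "j \<in> {1..<s}"
      then have jm: "1 \<le> j" "1 \<le> s - j" "j + (s - j) < n" and js: "j + (s - j) = s"
        using s by auto
      show "(\<Sum>\<pi>\<in>signed_perms n. ?w \<pi> * ?c \<pi> i s j)
          = fact n / fact (Suc s) * (real (s choose j) * p ^ j * q ^ (s - j))"
        using weight_of_chains[OF i jm pq] js by (simp add: mult.assoc del: fact_Suc)
    qed simp
    also have "\<dots> = fact n / fact (Suc s) * (1 - p ^ s - q ^ s)"
      using s by (subst sum_distrib_left[symmetric], subst sum_binomial_inner[OF pq]) simp_all
    finally show ?thesis by simp
  qed
  have "fact n * expected_napkinless n p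
      = (\<Sum>\<pi>\<in>signed_perms n. ?w \<pi> * (\<Sum>i\<in>{1..n}. of_bool (i \<in> napkinless n \<pi>)))"
    unfolding expected_napkinless_def q
    by (auto simp: napkinless_def Int_def intro!: sum.cong arg_cong[of _ _ card])
  also have "\<dots> = (\<Sum>\<pi>\<in>signed_perms n. \<Sum>i\<in>{1..n}. \<Sum>s\<in>{1..<n}. \<Sum>j\<in>{1..<s}. ?w \<pi> * ?c \<pi> i s j)"
    by (simp only: of_bool_napkinless[OF n] sum_distrib_left cong: sum.cong)
  also have "\<dots> = (\<Sum>i\<in>{1..n}. \<Sum>s\<in>{1..<n}. \<Sum>j\<in>{1..<s}. \<Sum>\<pi>\<in>signed_perms n. ?w \<pi> * ?c \<pi> i s j)"
  proof -
    have "(\<Sum>\<pi>\<in>signed_perms n. \<Sum>i\<in>{1..n}. \<Sum>s\<in>{1..<n}. \<Sum>j\<in>{1..<s}. ?w \<pi> * ?c \<pi> i s j)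
        = (\<Sum>i\<in>{1..n}. \<Sum>\<pi>\<in>signed_perms n. \<Sum>s\<in>{1..<n}. \<Sum>j\<in>{1..<s}. ?w \<pi> * ?c \<pi> i s j)"
      by (rule sum.swap)
    also have "\<dots> = (\<Sum>i\<in>{1..n}. \<Sum>s\<in>{1..<n}. \<Sum>\<pi>\<in>signed_perms n. \<Sum>j\<in>{1..<s}. ?w \<pi> * ?c \<pi> i s j)"
      by (intro sum.cong refl sum.swap)
    also have "\<dots> = (\<Sum>i\<in>{1..n}. \<Sum>s\<in>{1..<n}. \<Sum>j\<in>{1..<s}. \<Sum>\<pi>\<in>signed_perms n. ?w \<pi> * ?c \<pi> i s j)"
      by (intro sum.cong refl sum.swap)
    finally show ?thesis .
  qed
  also have "\<dots> = (\<Sum>i\<in>{1..n}. \<Sum>s\<in>{1..<n}. fact n * ((1 - p ^ s - q ^ s) / fact (Suc s)))"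
    by (intro sum.cong refl inner)
  also have "\<dots> = fact n * (real n * (\<Sum>s\<in>{1..<n}. (1 - p ^ s - q ^ s) / fact (Suc s)))"
    by (simp add: sum_distrib_left mult.left_commute del: fact_Suc)
  finally show ?thesis by simp
qed

section \<open>The asymptotics\<close>

lemma sums_power_div_fact_Suc:
  fixes x :: real
  assumes "x \<noteq> 0"
  shows "(\<lambda>s. x ^ s / fact (Suc s)) sums ((exp x - 1) / x)"
proof -
  have "(\<lambda>s. x ^ s / fact s) sums exp x"
    using exp_converges[of x] by (simp add: divide_inverse mult.commute)
  then have "(\<lambda>s. x ^ Suc s / fact (Suc s)) sums (exp x - 1)"
    by (subst sums_Suc_iff) simp
  from sums_divide[OF this, of x] show ?thesis
    using assms by simp
qed

text \<open>Compare with the exponential series, using \<open>fact t * fact (Suc n) \<le> fact (Suc (t + n))\<close>.\<close>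
lemma suminf_tail_fact_le:
  "summable (\<lambda>t. 1 / fact (Suc (t + n)) :: real)" (is ?S)
  "(\<Sum>t. 1 / fact (Suc (t + n)) :: real) \<le> exp 1 / fact (Suc n)" (is ?B)
proof -
  have le: "1 / fact (Suc (t + n)) \<le> 1 / fact t / (fact (Suc n) :: real)" for t
  proof -
    have "fact t * fact (Suc n) dvd (fact (t + Suc n) :: nat)"
      by (rule fact_fact_dvd_fact)
    then have "fact t * fact (Suc n) \<le> (fact (Suc (t + n)) :: nat)"
      by (intro dvd_imp_le) auto
    then have "real (fact t * fact (Suc n)) \<le> real (fact (Suc (t + n)))"
      by (simp only: of_nat_le_iff)
    then have "fact t * fact (Suc n) \<le> (fact (Suc (t + n)) :: real)"
      by (simp only: of_nat_mult of_nat_fact)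
    then have "1 / fact (Suc (t + n)) \<le> 1 / (fact t * fact (Suc n) :: real)"
      by (intro divide_left_mono) simp_all
    then show ?thesis by (simp only: divide_divide_eq_left)
  qed
  have "(\<lambda>t. 1 / fact t :: real) sums exp 1"
    using exp_converges[of "1::real"] by (simp add: divide_inverse)
  then have maj: "(\<lambda>t. 1 / fact t / fact (Suc n) :: real) sums (exp 1 / fact (Suc n))"
    by (rule sums_divide)
  show ?S
    using le by (intro summable_comparison_test'[OF sums_summable[OF maj]]) simp
  from suminf_le[OF le this sums_summable[OF maj]] show ?B
    by (simp only: sums_unique[OF maj, symmetric])
qed

text \<open>The series over all \<open>s\<close> is a combination of the series of \<open>(exp x - 1) / x\<close> at \<open>1\<close>, \<open>p\<close> and \<open>q\<close>.
  The tail from \<open>n\<close> on is at most \<open>exp 1 / fact (Suc n)\<close> in absolute value, and the factor \<open>n\<close> in front turns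
  this into the error bound.\<close>
lemma partial_sum_asymptotics:
  fixes p q :: real
  assumes "0 < p" "0 < q" "p + q = 1"
  shows "(\<lambda>n. real n * (\<Sum>s\<in>{1..<n}. (1 - p ^ s - q ^ s) / fact (Suc s))
      - real n * (1 - p * exp q) * (1 - q * exp p) / (p * q)) \<in> O(\<lambda>n. 1 / fact n)"
proof -
  define f where "f s = (1 - p ^ s - q ^ s) / fact (Suc s)" for s
  define c where "c = (1 - p * exp q) * (1 - q * exp p) / (p * q)"
  have "(\<lambda>s. 1 ^ s / fact (Suc s) - p ^ s / fact (Suc s) - q ^ s / fact (Suc s)) sums
      ((exp 1 - 1) / 1 - (exp p - 1) / p - (exp q - 1) / q)"
    using assms by (intro sums_diff sums_power_div_fact_Suc) auto
  also have "(exp 1 - 1) / 1 - (exp p - 1) / p - (exp q - 1) / q = c - 1"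
  proof -
    have e: "exp 1 = exp p * exp q" using assms(3) by (metis exp_add)
    have q: "q = 1 - p" using assms(3) by simp
    show ?thesis
      using assms(1,2) unfolding c_def e
      by (simp add: field_simps) (simp add: q algebra_simps)
  qed
  \<comment> \<open>The term at \<open>s = 0\<close> is \<open>- 1\<close>, so the terms from \<open>s = 1\<close> on add up to \<open>c\<close>.\<close>
  finally have f: "f sums (c - 1)"
    unfolding f_def by (simp add: diff_divide_distrib)
  have bound: "\<bar>f s\<bar> \<le> 1 / fact (Suc s)" if "s \<ge> 1" for s
  proof -
    have "p ^ s \<le> 1" "q ^ s \<le> 1" "0 \<le> p ^ s" "0 \<le> q ^ s"
      using assms by (auto intro!: power_le_one)
    then have "\<bar>1 - p ^ s - q ^ s\<bar> \<le> 1" by linarith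
    then show ?thesis
      unfolding f_def abs_divide by (simp add: divide_right_mono del: fact_Suc)
  qed
  have "norm (real n * sum f {1..<n} - real n * c) \<le> exp 1 * norm (1 / fact n :: real)"
    if n: "n \<ge> 1" for n
  proof -
    have "(\<Sum>t. f (t + n)) = (c - 1) - sum f {..<n}"
      using suminf_minus_initial_segment[OF sums_summable[OF f], of n] sums_unique[OF f] by simp
    moreover have "{..<n} = insert 0 {1..<n}" using n by auto
    moreover have "f 0 = - 1" by (simp add: f_def)
    ultimately have tail: "c - sum f {1..<n} = (\<Sum>t. f (t + n))" by simp
    have le: "norm (f (t + n)) \<le> 1 / fact (Suc (t + n))" for t
      using bound[of "t + n"] n by (simp del: fact_Suc)
    have "norm (\<Sum>t. f (t + n)) \<le> (\<Sum>t. 1 / fact (Suc (t + n)))"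
      using suminf_tail_fact_le(1) le by (rule norm_suminf_le[rotated])
    then have "\<bar>c - sum f {1..<n}\<bar> \<le> exp 1 / fact (Suc n)"
      unfolding tail real_norm_def using suminf_tail_fact_le(2) by (rule order_trans)
    then have "real n * \<bar>c - sum f {1..<n}\<bar> \<le> real (Suc n) * (exp 1 / fact (Suc n))"
      by (intro mult_mono) auto
    also have "\<dots> = exp 1 * norm (1 / fact n :: real)"
      by (simp add: field_simps del: of_nat_Suc)
    finally show ?thesis
      by (simp add: abs_mult abs_minus_commute flip: right_diff_distrib)
  qed
  then have "(\<lambda>n. real n * sum f {1..<n} - real n * c) \<in> O(\<lambda>n. 1 / fact n)"
    by (intro bigoI[where c = "exp 1"] eventually_sequentiallyI[of 1])
  then show ?thesis
    by (simp only: f_def[abs_def] c_def times_divide_eq_right mult.assoc)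
qed

lemma expected_napkinless_asymptotics:
  fixes p q :: real
  assumes "0 < p" "0 < q" "p + q = 1"
  shows "(\<lambda>n. expected_napkinless n p
      - real n * (1 - p * exp q) * (1 - q * exp p) / (p * q)) \<in> O(\<lambda>n. 1 / fact n)"
proof -
  have "eventually (\<lambda>n. expected_napkinless n p
        - real n * (1 - p * exp q) * (1 - q * exp p) / (p * q)
      = real n * (\<Sum>s\<in>{1..<n}. (1 - p ^ s - q ^ s) / fact (Suc s))
        - real n * (1 - p * exp q) * (1 - q * exp p) / (p * q)) sequentially"
    using assms(3) by (intro eventually_sequentiallyI[of 2]) (simp only: expected_napkinless_eq)
  from landau_o.big.in_cong[OF this] show ?thesis
    using partial_sum_asymptotics[OF assms] by (simp only:)
qed

theorem corollary2:
  fixes p q :: real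
  assumes "0 < p" and "p < 1" and "q = 1 - p"
  shows "(\<lambda>n. expected_napkinless n p
            - real n * (1 - p * exp q) * (1 - q * exp p) / (p * q)) \<in> O(\<lambda>n. 1 / fact n)
       \<and> (\<lambda>n. expected_napkinless n (1/2) - real n * (2 - sqrt (exp 1))\<^sup>2)
            \<in> O(\<lambda>n. 1 / fact n)"
proof
  show "(\<lambda>n. expected_napkinless n p
      - real n * (1 - p * exp q) * (1 - q * exp p) / (p * q)) \<in> O(\<lambda>n. 1 / fact n)"
    using assms by (intro expected_napkinless_asymptotics) auto
  have "(\<lambda>n. expected_napkinless n (1/2)
      - real n * (1 - 1/2 * exp (1/2)) * (1 - 1/2 * exp (1/2)) / (1/2 * (1/2))) \<in> O(\<lambda>n. 1 / fact n)"
    by (rule expected_napkinless_asymptotics) simp_all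
  moreover have "real n * (1 - 1/2 * x) * (1 - 1/2 * x) / (1/2 * (1/2)) = real n * (2 - x)\<^sup>2"
    for n and x :: real
    by (simp add: power2_eq_square field_simps)
  moreover have "sqrt (exp 1) = exp (1/2)"
    by (rule real_sqrt_unique) (simp_all flip: exp_double)
  ultimately show "(\<lambda>n. expected_napkinless n (1/2) - real n * (2 - sqrt (exp 1))\<^sup>2)
      \<in> O(\<lambda>n. 1 / fact n)"
    by (simp only:)
qed

end
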